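(* Let $a,b,c,d>0$ and $n,m\in\mathbb{N}$. Then for all $x$, $$\begin{aligned}W_{m+n}(x^2;a,b,c,d)=\sum_{k=0}^{\min(n,m)}&\frac{(-n)_k(-m)_k}{k!}\,(m+a+b+c+d+2n-1)_k\,(a+ix)_k(b+ix)_k(c+ix)_k(d+ix)_k\\&\times W_{n-k}\Bigl(\bigl(x-\tfrac12ki\bigr)^2;a+\tfrac k2,b+\tfrac k2,c+\tfrac k2,d+\tfrac k2\Bigr)\\&\times W_{m-k}\Bigl(\bigl(x+\tfrac12i(n-k)\bigr)^2;a+\tfrac{n+k}2,b+\tfrac{n+k}2,c+\tfrac{n+k}2,d+\tfrac{n+k}2\Bigr).\end{aligned}$$
   Context: $\mathbb N=\{0,1,2,\dots\}$, $i=\sqrt{-1}$, $(y)_k=y(y+1)\cdots(y+k-1)$ is the Pochhammer symbol. The Wilson polynomials (polynomials of degree $n$ in $x^2$) are $$W_n(x^2;a,b,c,d)=(a+b)_n(a+c)_n(a+d)_n\sum_{j=0}^n\frac{(-n)_j(n+a+b+c+d-1)_j(a+ix)_j(a-ix)_j}{(a+b)_j(a+c)_j(a+d)_j\,j!},$$ i.e. the factor times a terminating ${}_4F_3$ at argument $1$. As a polynomial in its first argument, $W_n$ may be evaluated at any complex number. *)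

theory Defs
  imports Complex_Main "HOL-Computational_Algebra.Polynomial"
begin

text \<open>
  \<open>wilson n a b c d\<close> is the Wilson polynomial $W_n(x^2;a,b,c,d)$ as a polynomial in its first
  argument $y = x^2$. The product of linear factors is $(a+ix)_j(a-ix)_j$ written in terms of $y$,
  since $(a+l+ix)(a+l-ix) = (a+l)^2+x^2$; lemma \<open>poly_wilson_square\<close> gives the usual
  formula. The quotients are meaningful only if none of $a+b$, $a+c$, $a+d$ is one of
  $0,-1,\dots,-(n-1)$.
\<close>

definition wilson :: "nat \<Rightarrow> complex \<Rightarrow> complex \<Rightarrow> complex \<Rightarrow> complex \<Rightarrow> complex poly" where
  "wilson n a b c d =
     smult (pochhammer (a + b) n * pochhammer (a + c) n * pochhammer (a + d) n)
       (\<Sum>j\<le>n. smult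
          (pochhammer (- of_nat n) j * pochhammer (of_nat n + a + b + c + d - 1) j /
            (pochhammer (a + b) j * pochhammer (a + c) j * pochhammer (a + d) j * fact j))
          (\<Prod>l<j. [:(a + of_nat l)\<^sup>2, 1:]))"

lemma poly_wilson_square:
  "poly (wilson n a b c d) (x\<^sup>2) =
     pochhammer (a + b) n * pochhammer (a + c) n * pochhammer (a + d) n *
     (\<Sum>j\<le>n.
        pochhammer (- of_nat n) j * pochhammer (of_nat n + a + b + c + d - 1) j *
        pochhammer (a + \<i> * x) j * pochhammer (a - \<i> * x) j /
        (pochhammer (a + b) j * pochhammer (a + c) j * pochhammer (a + d) j * fact j))"
proof -
  have "poly (\<Prod>l<j. [:(a + of_nat l)\<^sup>2, 1:]) (x\<^sup>2) =
      pochhammer (a + \<i> * x) j * pochhammer (a - \<i> * x) j" for j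
  proof (induction j)
    case 0
    then show ?case by simp
  next
    case (Suc j)
    have "(a + of_nat j)\<^sup>2 + x\<^sup>2 = (a + \<i> * x + of_nat j) * (a - \<i> * x + of_nat j)"
      by (simp add: algebra_simps power2_eq_square)
    moreover have "poly (\<Prod>l<Suc j. [:(a + of_nat l)\<^sup>2, 1:]) (x\<^sup>2) =
        pochhammer (a + \<i> * x) j * pochhammer (a - \<i> * x) j * ((a + of_nat j)\<^sup>2 + x\<^sup>2)"
      using Suc by (simp add: algebra_simps)
    ultimately show ?case
      by (simp only: pochhammer_Suc mult_ac)
  qed
  then show ?thesis
    by (simp add: wilson_def poly_sum mult_ac)
qed

end

theory Submission
  imports Defs
begin

text \<open>
  Put \<open>t = \<i> x\<close>. On functions of \<open>t\<close> consider the divided difference operator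
  $(Df)(t) = (f(t+\frac12) - f(t-\frac12))/(2t)$. It has two effects on Wilson polynomials.
  Applied to $W_n$ it lowers the degree and raises every parameter by $\frac12$
  (\<open>wilson_at_forward\<close>). Conjugated by the weight
  $\Phi_a(t) = \prod_{e \in \{a,b,c,d\}} \Gamma(e+t)\Gamma(e-t)$ it raises the degree
  and lowers the parameters (\<open>wilson_at_backward\<close>), so that
  $\Phi_a W_n(\cdot;a,b,c,d) = D^n \Phi_{a+n/2}$, a Rodrigues formula.

  Hence $\Phi_a W_{m+n}$ is $D^n$ applied to the product
  $\Phi_{a+n/2} \cdot W_m(\cdot;a+\frac n2,\dots)$. Since $D^n f(t)$ is \<open>n!\<close> times the
  divided difference of the values $f(t+\frac n2-j)$ at the nodes $(t+\frac n2-j)^2$,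
  \<open>j = 0, \<dots>, n\<close>, the Leibniz rule for divided differences expands this into a sum over \<open>k\<close>, in which $n-k$ differences act on
  the weight and produce $W_{n-k}$, while \<open>k\<close> differences act on $W_m$ and produce $W_{m-k}$;
  the points left to each factor account for the shifts of \<open>x\<close>.

  The proof below carries out the Leibniz rule as an induction on \<open>n\<close>
  (\<open>wilson_at_add\<close>), which makes the weight cancel, so no Gamma function occurs. Each step
  only needs the two shift relations and an identity between binomial coefficients
  (\<open>binomial_leibniz_sum\<close>).
\<close>

section \<open>Wilson polynomials without denominators\<close>

definition wilson_coeff :: "nat \<Rightarrow> complex \<Rightarrow> nat \<Rightarrow> complex" where
  "wilson_coeff n s j = pochhammer (- of_nat n) j * pochhammer (of_nat n + s - 1) j / fact j"

text \<open>
  This is $W_n$ at $x^2 = -t^2$. The quotients $(a+b)_n/(a+b)_j$ are written as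
  $(a+b+j)_{n-j}$, so that the shift relations hold for all complex parameters.
\<close>

definition wilson_at ::
    "nat \<Rightarrow> complex \<Rightarrow> complex \<Rightarrow> complex \<Rightarrow> complex \<Rightarrow> complex \<Rightarrow> complex" where
  "wilson_at n a b c d t =
     (\<Sum>j\<le>n. wilson_coeff n (a + b + c + d) j *
        (pochhammer (a + b + of_nat j) (n - j) * pochhammer (a + c + of_nat j) (n - j) *
         pochhammer (a + d + of_nat j) (n - j)) *
        (pochhammer (a + t) j * pochhammer (a - t) j))"

lemma pochhammer_neq_0_of_Re_pos:
  fixes z :: complex
  assumes "Re z > 0"
  shows "pochhammer z n \<noteq> 0"
proof
  assume "pochhammer z n = 0"
  then obtain k where "z = - of_nat k"
    by (auto simp: pochhammer_eq_0_iff)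
  with assms show False by simp
qed

lemma poly_wilson_eq_wilson_at:
  assumes "Re a > 0" "Re b > 0" "Re c > 0" "Re d > 0"
  shows "poly (wilson n a b c d) (x\<^sup>2) = wilson_at n a b c d (\<i> * x)"
proof -
  have quot: "pochhammer (a + e + of_nat j) (n - j) = pochhammer (a + e) n / pochhammer (a + e) j"
    if "Re e > 0" "j \<le> n" for e j
    using pochhammer_product[OF that(2), of "a + e"] pochhammer_neq_0_of_Re_pos[of "a + e" j]
      that assms(1) by simp
  show ?thesis
    unfolding poly_wilson_square wilson_at_def wilson_coeff_def sum_distrib_left
    by (intro sum.cong refl) (simp add: quot assms mult_ac flip: add.assoc)
qed

section \<open>The shift relations\<close>

text \<open>
  The basis functions $(a+t)_j(a-t)_j$ are adapted to the quadratic lattice: their divided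
  difference is again a basis function, for the parameter $a+\frac12$. The forward shift is
  therefore a termwise statement.
\<close>

lemma basis_forward:
  fixes a t :: complex
  shows "pochhammer (a + (t + 1/2)) (Suc j) * pochhammer (a - (t + 1/2)) (Suc j) -
         pochhammer (a + (t - 1/2)) (Suc j) * pochhammer (a - (t - 1/2)) (Suc j) =
         - (2 * t * of_nat (Suc j)) *
           (pochhammer (a + 1/2 + t) j * pochhammer (a + 1/2 - t) j)"
proof -
  have up: "pochhammer (a + (t + 1/2)) (Suc j) =
      pochhammer (a + 1/2 + t) j * (a + 1/2 + t + of_nat j)"
    "pochhammer (a - (t - 1/2)) (Suc j) =
      pochhammer (a + 1/2 - t) j * (a + 1/2 - t + of_nat j)"
    by (simp_all add: pochhammer_Suc algebra_simps)
  have down: "pochhammer (a - (t + 1/2)) (Suc j) =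
      (a - 1/2 - t) * pochhammer (a + 1/2 - t) j"
    "pochhammer (a + (t - 1/2)) (Suc j) =
      (a - 1/2 + t) * pochhammer (a + 1/2 + t) j"
    by (simp_all add: pochhammer_rec algebra_simps)
  show ?thesis
    unfolding up down by (simp add: field_simps)
qed

lemma wilson_coeff_forward:
  "- (of_nat (Suc j)) * wilson_coeff (Suc n) s (Suc j) =
     of_nat (Suc n) * (of_nat n + s) * wilson_coeff n (s + 2) j"
proof -
  define P Q where "P = pochhammer (- of_nat n :: complex) j"
    and "Q = pochhammer (of_nat n + (s + 2) - 1) j"
  have rec: "pochhammer (- of_nat (Suc n)) (Suc j) = - of_nat (Suc n) * P"
    "pochhammer (of_nat (Suc n) + s - 1) (Suc j) = (of_nat n + s) * Q"
    by (simp_all add: P_def Q_def pochhammer_rec algebra_simps)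
  have [simp]: "(1 + of_nat j :: complex) \<noteq> 0"
    by (metis of_nat_Suc of_nat_neq_0)
  show ?thesis
    unfolding wilson_coeff_def rec P_def[symmetric] Q_def[symmetric]
    by (simp add: divide_simps) algebra
qed

lemma wilson_at_forward:
  "wilson_at n a b c d (t + 1/2) - wilson_at n a b c d (t - 1/2) =
     2 * t * of_nat n * (of_nat n + a + b + c + d - 1) *
       wilson_at (n - 1) (a + 1/2) (b + 1/2) (c + 1/2) (d + 1/2) t"
proof (cases n)
  case 0
  then show ?thesis by (simp add: wilson_at_def)
next
  case (Suc N)
  let ?s = "a + b + c + d"
  let ?p = "\<lambda>j. pochhammer (a + b + of_nat j) (n - j) * pochhammer (a + c + of_nat j) (n - j) *
    pochhammer (a + d + of_nat j) (n - j)"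
  let ?f = "\<lambda>j. pochhammer (a + 1/2 + t) j * pochhammer (a + 1/2 - t) j"
  have "wilson_at n a b c d (t + 1/2) - wilson_at n a b c d (t - 1/2) =
      (\<Sum>j\<le>n. wilson_coeff n ?s j * ?p j *
        (pochhammer (a + (t + 1/2)) j * pochhammer (a - (t + 1/2)) j -
         pochhammer (a + (t - 1/2)) j * pochhammer (a - (t - 1/2)) j))"
    by (simp only: wilson_at_def sum_subtractf right_diff_distrib)
  also have "\<dots> = (\<Sum>j\<le>N. wilson_coeff n ?s (Suc j) * ?p (Suc j) *
        (- (2 * t * of_nat (Suc j)) * ?f j))"
    unfolding Suc sum.atMost_Suc_shift basis_forward by simp
  also have "\<dots> = (\<Sum>j\<le>N. 2 * t * ?p (Suc j) * ?f j *
        (- (of_nat (Suc j)) * wilson_coeff n ?s (Suc j)))"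
    by (intro sum.cong refl) (simp only: mult_minus_left mult_minus_right mult_ac)
  also have "\<dots> = 2 * t * of_nat n * (of_nat N + ?s) *
      (\<Sum>j\<le>N. wilson_coeff N (?s + 2) j * ?p (Suc j) * ?f j)"
    unfolding Suc wilson_coeff_forward sum_distrib_left
    by (intro sum.cong refl) (simp only: mult_ac)
  also have "(\<Sum>j\<le>N. wilson_coeff N (?s + 2) j * ?p (Suc j) * ?f j) =
      wilson_at N (a + 1/2) (b + 1/2) (c + 1/2) (d + 1/2) t"
  proof -
    have *: "a + 1/2 + (e + 1/2) + of_nat j = a + e + of_nat (Suc j)" for e j
      by simp
    have **: "a + 1/2 + (b + 1/2) + (c + 1/2) + (d + 1/2) = ?s + 2"
      by simp
    show ?thesis
      unfolding wilson_at_def * ** Suc by simp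
  qed
  finally show ?thesis
    by (simp add: Suc add.assoc)
qed

text \<open>
  The backward shift operator sends the basis function of index \<open>j\<close> for $a+\frac12$ to $2t$ times
  the one for \<open>a\<close> times a polynomial of degree 1 in $t^2$. Expanding that polynomial in powers
  of $(a+j)^2-t^2$ gives two neighbouring basis functions; its value at $t = a+j$ factorises,
  because one of its two products contains $a+j-t$ and vanishes there.
\<close>

lemma basis_backward:
  fixes a b c d t :: complex
  shows "(a + t) * (b + t) * (c + t) * (d + t) *
           (pochhammer (a + 1/2 + (t + 1/2)) j * pochhammer (a + 1/2 - (t + 1/2)) j) -
         (a - t) * (b - t) * (c - t) * (d - t) *
           (pochhammer (a + 1/2 + (t - 1/2)) j * pochhammer (a + 1/2 - (t - 1/2)) j) =
         2 * t * ((a + b + of_nat j) * (a + c + of_nat j) * (a + d + of_nat j) *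
             (pochhammer (a + t) j * pochhammer (a - t) j) -
           (a + b + c + d + of_nat j) *
             (pochhammer (a + t) (Suc j) * pochhammer (a - t) (Suc j)))"
proof -
  have up: "(a + t) * pochhammer (a + 1/2 + (t + 1/2)) j =
      pochhammer (a + t) j * (a + t + of_nat j)"
    "(a - t) * pochhammer (a + 1/2 - (t - 1/2)) j = pochhammer (a - t) j * (a - t + of_nat j)"
    using pochhammer_rec[of "a + t" j] pochhammer_rec[of "a - t" j]
    by (simp_all add: pochhammer_Suc algebra_simps)
  have same: "a + 1/2 - (t + 1/2) = a - t" "a + 1/2 + (t - 1/2) = a + t"
    by simp_all
  define P Q J where "P = pochhammer (a + t) j" and "Q = pochhammer (a - t) j"
    and "J = (of_nat j :: complex)"
  have "(a + t) * (b + t) * (c + t) * (d + t) *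
           (pochhammer (a + 1/2 + (t + 1/2)) j * pochhammer (a + 1/2 - (t + 1/2)) j) -
         (a - t) * (b - t) * (c - t) * (d - t) *
           (pochhammer (a + 1/2 + (t - 1/2)) j * pochhammer (a + 1/2 - (t - 1/2)) j) =
        (b + t) * (c + t) * (d + t) *
           ((a + t) * pochhammer (a + 1/2 + (t + 1/2)) j) * pochhammer (a - t) j -
         (b - t) * (c - t) * (d - t) *
           ((a - t) * pochhammer (a + 1/2 - (t - 1/2)) j) * pochhammer (a + t) j"
    unfolding same by (simp only: mult_ac)
  also have "\<dots> = (b + t) * (c + t) * (d + t) * (P * (a + t + J)) * Q -
      (b - t) * (c - t) * (d - t) * (Q * (a - t + J)) * P"
    unfolding up P_def Q_def J_def ..
  also have "\<dots> = 2 * t * ((a + b + J) * (a + c + J) * (a + d + J) * (P * Q) -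
           (a + b + c + d + J) * (P * (a + t + J) * (Q * (a - t + J))))"
    by algebra
  finally show ?thesis
    by (simp only: P_def Q_def J_def pochhammer_Suc)
qed

lemma wilson_coeff_backward:
  "wilson_coeff (Suc n) s (Suc j) =
     wilson_coeff n (s + 2) (Suc j) - (s + of_nat j) * wilson_coeff n (s + 2) j"
proof -
  define P Q where "P = pochhammer (- of_nat n :: complex) j"
    and "Q = pochhammer (of_nat n + (s + 2) - 1) j"
  have left: "pochhammer (- of_nat (Suc n)) (Suc j) = - of_nat (Suc n) * P"
    "pochhammer (of_nat (Suc n) + s - 1) (Suc j) = (of_nat n + s) * Q"
    by (simp_all add: P_def Q_def pochhammer_rec algebra_simps)
  have right: "pochhammer (- of_nat n) (Suc j) = P * (- of_nat n + of_nat j)"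
    "pochhammer (of_nat n + (s + 2) - 1) (Suc j) = Q * (of_nat n + (s + 2) - 1 + of_nat j)"
    by (simp_all add: P_def Q_def pochhammer_Suc)
  have [simp]: "(1 + of_nat j :: complex) \<noteq> 0"
    by (metis of_nat_Suc of_nat_neq_0)
  show ?thesis
    unfolding wilson_coeff_def left right P_def[symmetric] Q_def[symmetric]
    by (simp add: divide_simps) algebra
qed

lemma wilson_at_backward:
  "(a + t) * (b + t) * (c + t) * (d + t) *
     wilson_at n (a + 1/2) (b + 1/2) (c + 1/2) (d + 1/2) (t + 1/2) -
   (a - t) * (b - t) * (c - t) * (d - t) *
     wilson_at n (a + 1/2) (b + 1/2) (c + 1/2) (d + 1/2) (t - 1/2) =
   2 * t * wilson_at (Suc n) a b c d t"
proof -
  let ?s = "a + b + c + d"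
  let ?q = "\<lambda>j. pochhammer (a + b + of_nat (Suc j)) (n - j) *
    pochhammer (a + c + of_nat (Suc j)) (n - j) * pochhammer (a + d + of_nat (Suc j)) (n - j)"
  let ?p = "\<lambda>j. pochhammer (a + b + of_nat j) (Suc n - j) *
    pochhammer (a + c + of_nat j) (Suc n - j) * pochhammer (a + d + of_nat j) (Suc n - j)"
  let ?f = "\<lambda>j. pochhammer (a + t) j * pochhammer (a - t) j"
  let ?e = "\<lambda>j. wilson_coeff n (?s + 2) j"
  let ?A = "(a + t) * (b + t) * (c + t) * (d + t)"
  let ?B = "(a - t) * (b - t) * (c - t) * (d - t)"
  have *: "a + 1/2 + (e + 1/2) + of_nat j = a + e + of_nat (Suc j)" for e j
    by simp
  have **: "a + 1/2 + (b + 1/2) + (c + 1/2) + (d + 1/2) = ?s + 2"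
    by simp
  have step: "?A * (?e j * ?q j *
         (pochhammer (a + 1/2 + (t + 1/2)) j * pochhammer (a + 1/2 - (t + 1/2)) j)) -
       ?B * (?e j * ?q j *
         (pochhammer (a + 1/2 + (t - 1/2)) j * pochhammer (a + 1/2 - (t - 1/2)) j)) =
       2 * t * (?e j * ?p j * ?f j - (?s + of_nat j) * ?e j * ?p (Suc j) * ?f (Suc j))"
    if "j \<le> n" for j
  proof -
    have q: "(a + b + of_nat j) * (a + c + of_nat j) * (a + d + of_nat j) * ?q j = ?p j"
      using that by (simp add: Suc_diff_le pochhammer_rec add_ac mult_ac)
    have "?A * (?e j * ?q j *
         (pochhammer (a + 1/2 + (t + 1/2)) j * pochhammer (a + 1/2 - (t + 1/2)) j)) -
       ?B * (?e j * ?q j *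
         (pochhammer (a + 1/2 + (t - 1/2)) j * pochhammer (a + 1/2 - (t - 1/2)) j)) =
       ?e j * ?q j * (?A *
         (pochhammer (a + 1/2 + (t + 1/2)) j * pochhammer (a + 1/2 - (t + 1/2)) j) -
       ?B *
         (pochhammer (a + 1/2 + (t - 1/2)) j * pochhammer (a + 1/2 - (t - 1/2)) j))"
      by (simp only: right_diff_distrib mult_ac)
    also have "\<dots> = 2 * t * (?e j * ((a + b + of_nat j) * (a + c + of_nat j) *
        (a + d + of_nat j) * ?q j) * ?f j - (?s + of_nat j) * ?e j * ?q j * ?f (Suc j))"
      unfolding basis_backward by (simp only: right_diff_distrib mult_ac)
    finally show ?thesis
      unfolding q by simp
  qed
  have "?A * wilson_at n (a + 1/2) (b + 1/2) (c + 1/2) (d + 1/2) (t + 1/2) -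
      ?B * wilson_at n (a + 1/2) (b + 1/2) (c + 1/2) (d + 1/2) (t - 1/2) =
      (\<Sum>j\<le>n. 2 * t * (?e j * ?p j * ?f j - (?s + of_nat j) * ?e j * ?p (Suc j) * ?f (Suc j)))"
    unfolding wilson_at_def * ** sum_distrib_left sum_subtractf[symmetric]
    by (intro sum.cong refl step) simp
  also have "\<dots> = 2 * t * ((\<Sum>j\<le>n. ?e j * ?p j * ?f j) -
      (\<Sum>j\<le>n. (?s + of_nat j) * ?e j * ?p (Suc j) * ?f (Suc j)))"
    by (simp only: sum_distrib_left[symmetric] sum_subtractf)
  \<comment> \<open>The added term vanishes because $(-n)_{n+1} = 0$.\<close>
  also have "(\<Sum>j\<le>n. ?e j * ?p j * ?f j) = (\<Sum>j\<le>Suc n. ?e j * ?p j * ?f j)"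
    by (simp add: wilson_coeff_def pochhammer_of_nat_eq_0_lemma)
  also have "\<dots> = ?e 0 * ?p 0 * ?f 0 + (\<Sum>j\<le>n. ?e (Suc j) * ?p (Suc j) * ?f (Suc j))"
    by (rule sum.atMost_Suc_shift)
  also have "\<dots> - (\<Sum>j\<le>n. (?s + of_nat j) * ?e j * ?p (Suc j) * ?f (Suc j)) =
      ?e 0 * ?p 0 * ?f 0 + (\<Sum>j\<le>n. wilson_coeff (Suc n) ?s (Suc j) * ?p (Suc j) * ?f (Suc j))"
    unfolding wilson_coeff_backward left_diff_distrib sum_subtractf by (simp only: add_diff_eq)
  also have "\<dots> = wilson_at (Suc n) a b c d t"
    unfolding wilson_at_def sum.atMost_Suc_shift[of _ n] by (simp add: wilson_coeff_def)
  finally show ?thesis .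
qed

section \<open>The Leibniz rule\<close>

lemma binomial_leibniz_sum:
  fixes h :: "nat \<Rightarrow> complex"
  shows "(\<Sum>k\<le>n. of_nat (n choose k) * ((u + of_nat k) * h k +
      (u - of_nat n + of_nat k) * h (Suc k))) =
    u * (\<Sum>k\<le>Suc n. of_nat (Suc n choose k) * h k)"
proof -
  have absorb: "of_nat (n choose Suc k) * (1 + of_nat k :: complex) =
      of_nat (n choose k) * (of_nat n - of_nat k)" if "k \<le> n" for k
  proof -
    have "Suc k * (n choose Suc k) = (n - k) * (n choose k)"
      by (simp only: binomial_absorb_comp binomial_absorption)
    then have "of_nat (Suc k * (n choose Suc k)) = (of_nat ((n - k) * (n choose k)) :: complex)"
      by simp
    then show ?thesis
      using that by (simp add: of_nat_diff algebra_simps)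
  qed
  have "(\<Sum>k\<le>n. of_nat (n choose k) * (u + of_nat k) * h k) =
      (\<Sum>k\<le>Suc n. of_nat (n choose k) * (u + of_nat k) * h k)"
    by simp
  also have "\<dots> = u * h 0 + (\<Sum>k\<le>n. of_nat (n choose Suc k) * (u + of_nat (Suc k)) * h (Suc k))"
    unfolding sum.atMost_Suc_shift by simp
  finally have first: "(\<Sum>k\<le>n. of_nat (n choose k) * (u + of_nat k) * h k) =
      u * h 0 + (\<Sum>k\<le>n. of_nat (n choose Suc k) * (u + of_nat (Suc k)) * h (Suc k))" .
  have "(\<Sum>k\<le>n. of_nat (n choose k) * ((u + of_nat k) * h k +
      (u - of_nat n + of_nat k) * h (Suc k))) =
      u * h 0 + (\<Sum>k\<le>n. of_nat (n choose Suc k) * (u + of_nat (Suc k)) * h (Suc k) +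
        of_nat (n choose k) * (u - of_nat n + of_nat k) * h (Suc k))"
    by (simp only: distrib_left[of "of_nat (n choose _)" "_ * h _"] sum.distrib
        mult.assoc[symmetric] first add.assoc)
  also have "\<dots> = u * h 0 + (\<Sum>k\<le>n. u * (of_nat (Suc n choose Suc k) * h (Suc k)))"
  proof (intro arg_cong2[where f = "(+)"] sum.cong refl)
    fix k assume "k \<in> {..n}"
    then have "of_nat (n choose Suc k) * (1 + of_nat k :: complex) =
        of_nat (n choose k) * (of_nat n - of_nat k)"
      by (intro absorb) simp
    then show "of_nat (n choose Suc k) * (u + of_nat (Suc k)) * h (Suc k) +
        of_nat (n choose k) * (u - of_nat n + of_nat k) * h (Suc k) =
        u * (of_nat (Suc n choose Suc k) * h (Suc k))"
      unfolding binomial_Suc_Suc of_nat_add of_nat_Suc by algebra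
  qed
  also have "\<dots> = u * (\<Sum>k\<le>Suc n. of_nat (Suc n choose k) * h k)"
    unfolding sum.atMost_Suc_shift by (simp add: distrib_left sum_distrib_left)
  finally show ?thesis .
qed

text \<open>
  Of the $n+1$ points $t+\frac n2-j$, the first $n-k+1$ are centred at $t+\frac k2$ and the last
  $k+1$ at $t-\frac{n-k}2$; they share one point. Hence the arguments of the two polynomials. The
  factors $(a+t)_k \cdots (d+t)_k$ are the quotient of the weights
  $\Phi_{a+k/2}(t+\frac k2)$ and $\Phi_a(t)$, and the remaining Pochhammer symbols
  collect the constants from \<open>k\<close> forward shifts of $W_m$.
\<close>

definition leibniz_term ::
    "nat \<Rightarrow> nat \<Rightarrow> complex \<Rightarrow> complex \<Rightarrow> complex \<Rightarrow> complex \<Rightarrow> complex \<Rightarrow> nat \<Rightarrow> complex" where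
  "leibniz_term n m a b c d t k =
     (-1) ^ k * pochhammer (- of_nat m) k *
     pochhammer (of_nat m + a + b + c + d + 2 * of_nat n - 1) k *
     (pochhammer (a + t) k * pochhammer (b + t) k * pochhammer (c + t) k * pochhammer (d + t) k) *
     wilson_at (n - k) (a + of_nat k / 2) (b + of_nat k / 2) (c + of_nat k / 2) (d + of_nat k / 2)
       (t + of_nat k / 2) *
     wilson_at (m - k) (a + of_nat (n + k) / 2) (b + of_nat (n + k) / 2) (c + of_nat (n + k) / 2)
       (d + of_nat (n + k) / 2) (t - (of_nat n - of_nat k) / 2)"

lemma continuous_pochhammer [continuous_intros]:
  fixes f :: "complex \<Rightarrow> complex"
  shows "continuous_on S f \<Longrightarrow> continuous_on S (\<lambda>t. pochhammer (f t) k)"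
  unfolding pochhammer_prod by (intro continuous_intros)

lemma continuous_wilson_at [continuous_intros]:
  "continuous_on S f \<Longrightarrow> continuous_on S (\<lambda>t. wilson_at n a b c d (f t))"
  unfolding wilson_at_def by (intro continuous_intros)

lemma continuous_eq_off_0:
  fixes f g :: "complex \<Rightarrow> complex"
  assumes "continuous_on UNIV f" "continuous_on UNIV g" "\<And>t. t \<noteq> 0 \<Longrightarrow> f t = g t"
  shows "f t = g t"
proof (cases "t = 0")
  case True
  have "f \<midarrow>0\<rightarrow> f 0" "g \<midarrow>0\<rightarrow> g 0"
    using assms(1,2) by (auto simp: continuous_on_def)
  moreover have "f \<midarrow>0\<rightarrow> g 0 \<longleftrightarrow> g \<midarrow>0\<rightarrow> g 0"
    using assms(3) by (intro LIM_cong) auto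
  ultimately show ?thesis
    using True LIM_unique by blast
qed (use assms(3) in auto)

text \<open>
  One step of the Leibniz rule: the difference of a product \<open>F G\<close> is
  $(F^+ - F^-)\,G^- + F^+(G^+ - G^-)$. The first part is a backward shift of the weighted factor
  and keeps \<open>k\<close>, the second is a forward shift of the other factor and raises \<open>k\<close>.
\<close>

lemma leibniz_term_step:
  assumes "k \<le> n"
  shows "(a + t) * (b + t) * (c + t) * (d + t) *
      leibniz_term n m (a + 1/2) (b + 1/2) (c + 1/2) (d + 1/2) (t + 1/2) k -
    (a - t) * (b - t) * (c - t) * (d - t) *
      leibniz_term n m (a + 1/2) (b + 1/2) (c + 1/2) (d + 1/2) (t - 1/2) k =
    (2 * t + of_nat k) * leibniz_term (Suc n) m a b c d t k +
    (2 * t - of_nat n + of_nat k) * leibniz_term (Suc n) m a b c d t (Suc k)"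
proof -
  define E :: "nat \<Rightarrow> complex" where "E k = (-1) ^ k * pochhammer (- of_nat m) k *
     pochhammer (of_nat m + a + b + c + d + 2 * of_nat (Suc n) - 1) k" for k
  define P where "P = pochhammer (a + t) k * pochhammer (b + t) k * pochhammer (c + t) k *
    pochhammer (d + t) k"
  let ?A = "(a + t) * (b + t) * (c + t) * (d + t)"
  let ?B = "(a - t) * (b - t) * (c - t) * (d - t)"
  let ?Ak = "(a + t + of_nat k) * (b + t + of_nat k) * (c + t + of_nat k) * (d + t + of_nat k)"
  let ?h = "\<lambda>z. z + of_nat (Suc k) / 2 :: complex"
  let ?F = "wilson_at (n - k) (?h a) (?h b) (?h c) (?h d)"
  define Fp Fm where "Fp = ?F (t + of_nat k / 2 + 1/2)" and "Fm = ?F (t + of_nat k / 2 - 1/2)"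
  let ?g = "\<lambda>z. z + of_nat (Suc (n + k)) / 2 :: complex"
  let ?G = "wilson_at (m - k) (?g a) (?g b) (?g c) (?g d)"
  define Gp Gm where "Gp = ?G (t - (of_nat n - of_nat k) / 2 + 1/2)"
    and "Gm = ?G (t - (of_nat n - of_nat k) / 2 - 1/2)"
  define F' where "F' = wilson_at (Suc (n - k)) (a + of_nat k / 2) (b + of_nat k / 2)
    (c + of_nat k / 2) (d + of_nat k / 2) (t + of_nat k / 2)"
  let ?g' = "\<lambda>z. z + of_nat (Suc n + Suc k) / 2 :: complex"
  define G' where "G' = wilson_at (m - Suc k) (?g' a) (?g' b) (?g' c) (?g' d)
    (t - (of_nat n - of_nat k) / 2)"

  have half: "z + of_nat k / 2 + 1/2 = ?h z" "z + 1/2 + of_nat k / 2 = ?h z"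
    "z + 1/2 + of_nat (n + k) / 2 = ?g z" "?g z + 1/2 = ?g' z" for z :: complex
    by (simp_all add: field_simps)

  have F: "?Ak * Fp - ?B * Fm = (2 * t + of_nat k) * F'"
  proof -
    have "z + of_nat k / 2 + (t + of_nat k / 2) = z + t + of_nat k"
      "z + of_nat k / 2 - (t + of_nat k / 2) = z - t" for z :: complex
      by simp_all
    moreover have "2 * (t + of_nat k / 2) = 2 * t + of_nat k"
      by simp
    ultimately show ?thesis
      using wilson_at_backward[of "a + of_nat k / 2" "t + of_nat k / 2" "b + of_nat k / 2"
          "c + of_nat k / 2" "d + of_nat k / 2" "n - k"]
      unfolding Fp_def Fm_def F'_def by (simp only: half)
  qed

  have G: "E k * (Gp - Gm) = (2 * t - of_nat n + of_nat k) * E (Suc k) * G'"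
  proof (cases "k \<le> m")
    case True
    have "Gp - Gm = 2 * (t - (of_nat n - of_nat k) / 2) * of_nat (m - k) *
        (of_nat (m - k) + ?g a + ?g b + ?g c + ?g d - 1) * G'"
      unfolding Gp_def Gm_def G'_def wilson_at_forward half by simp
    moreover have "E (Suc k) = E k * (of_nat (m - k) *
        (of_nat (m - k) + ?g a + ?g b + ?g c + ?g d - 1))"
      using True unfolding E_def by (simp add: pochhammer_Suc of_nat_diff field_simps)
    moreover have "2 * (t - (of_nat n - of_nat k) / 2) = 2 * t - of_nat n + of_nat k"
      by (simp add: field_simps)
    ultimately show ?thesis
      by (simp only: mult_ac)
  next
    case False
    \<comment> \<open>Beyond \<open>m\<close> both sides vanish through $(-m)_k = 0$.\<close>
    then have "E k = 0" "E (Suc k) = 0"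
      by (simp_all add: E_def pochhammer_of_nat_eq_0_lemma)
    then show ?thesis by simp
  qed

  have s: "of_nat m + (a + 1/2) + (b + 1/2) + (c + 1/2) + (d + 1/2) + 2 * of_nat n - 1 =
      of_nat m + a + b + c + d + 2 * of_nat (Suc n) - 1"
    by simp
  have A: "?A * (pochhammer (a + 1/2 + (t + 1/2)) k * pochhammer (b + 1/2 + (t + 1/2)) k *
      pochhammer (c + 1/2 + (t + 1/2)) k * pochhammer (d + 1/2 + (t + 1/2)) k) = P * ?Ak"
  proof -
    have "(z + t) * pochhammer (z + 1/2 + (t + 1/2)) k = pochhammer (z + t) k * (z + t + of_nat k)"
      for z
      using pochhammer_rec[of "z + t" k] by (simp add: pochhammer_Suc algebra_simps)
    from this[of a] this[of b] this[of c] this[of d] show ?thesis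
      unfolding P_def by algebra
  qed
  have plus: "?A * leibniz_term n m (a + 1/2) (b + 1/2) (c + 1/2) (d + 1/2) (t + 1/2) k =
      E k * (P * ?Ak) * Fp * Gp"
  proof -
    have "t + 1/2 + of_nat k / 2 = t + of_nat k / 2 + 1/2"
      "t + 1/2 - (of_nat n - of_nat k) / 2 = t - (of_nat n - of_nat k) / 2 + 1/2"
      by simp_all
    then show ?thesis
      unfolding leibniz_term_def half s A[symmetric] Fp_def Gp_def E_def by (simp only: mult_ac)
  qed
  have minus: "?B * leibniz_term n m (a + 1/2) (b + 1/2) (c + 1/2) (d + 1/2) (t - 1/2) k =
      E k * P * ?B * Fm * Gm"
  proof -
    have "t - 1/2 + of_nat k / 2 = t + of_nat k / 2 - 1/2"
      "t - 1/2 - (of_nat n - of_nat k) / 2 = t - (of_nat n - of_nat k) / 2 - 1/2"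
      by simp_all
    moreover have "z + 1/2 + (t - 1/2) = z + t" for z
      by simp
    ultimately show ?thesis
      unfolding leibniz_term_def half s P_def Fm_def Gm_def E_def by (simp only: mult_ac)
  qed
  have same: "leibniz_term (Suc n) m a b c d t k = E k * P * F' * Gm"
  proof -
    have "t - (of_nat (Suc n) - of_nat k) / 2 = t - (of_nat n - of_nat k) / 2 - 1/2"
      by (simp add: field_simps)
    then show ?thesis
      using assms unfolding leibniz_term_def P_def F'_def Gm_def E_def
      by (simp only: Suc_diff_le add_Suc)
  qed
  have next_term: "leibniz_term (Suc n) m a b c d t (Suc k) = E (Suc k) * (P * ?Ak) * Fp * G'"
  proof -
    have "t + of_nat (Suc k) / 2 = t + of_nat k / 2 + 1/2"
      "t - (of_nat (Suc n) - of_nat (Suc k)) / 2 = t - (of_nat n - of_nat k) / 2"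
      by (simp_all add: field_simps)
    then show ?thesis
      unfolding leibniz_term_def P_def Fp_def G'_def E_def
      by (simp only: diff_Suc_Suc pochhammer_Suc[of "_ + t"] mult_ac)
  qed
  show ?thesis
    unfolding plus minus same next_term using F G by algebra
qed

lemma wilson_at_add:
  "wilson_at (m + n) a b c d t = (\<Sum>k\<le>n. of_nat (n choose k) * leibniz_term n m a b c d t k)"
proof (induction n arbitrary: a b c d t)
  case 0
  show ?case
    by (simp add: leibniz_term_def) (simp add: wilson_at_def wilson_coeff_def)
next
  case (Suc n)
  let ?A = "\<lambda>t. (a + t) * (b + t) * (c + t) * (d + t)"
  let ?B = "\<lambda>t. (a - t) * (b - t) * (c - t) * (d - t)"
  let ?L = "\<lambda>t. leibniz_term n m (a + 1/2) (b + 1/2) (c + 1/2) (d + 1/2) t"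
  have scaled: "2 * t * wilson_at (m + Suc n) a b c d t =
      2 * t * (\<Sum>k\<le>Suc n. of_nat (Suc n choose k) * leibniz_term (Suc n) m a b c d t k)" for t
  proof -
    have "2 * t * wilson_at (m + Suc n) a b c d t =
        (\<Sum>k\<le>n. of_nat (n choose k) * (?A t * ?L (t + 1/2) k - ?B t * ?L (t - 1/2) k))"
      unfolding add_Suc_right wilson_at_backward[symmetric] Suc.IH sum_distrib_left
        sum_subtractf[symmetric]
      by (intro sum.cong refl) (simp only: right_diff_distrib mult_ac)
    also have "\<dots> = (\<Sum>k\<le>n. of_nat (n choose k) *
        ((2 * t + of_nat k) * leibniz_term (Suc n) m a b c d t k +
         (2 * t - of_nat n + of_nat k) * leibniz_term (Suc n) m a b c d t (Suc k)))"
      by (intro sum.cong refl) (simp only: leibniz_term_step atMost_iff)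
    finally show ?thesis
      unfolding binomial_leibniz_sum .
  qed
  have off_0: "wilson_at (m + Suc n) a b c d t =
      (\<Sum>k\<le>Suc n. of_nat (Suc n choose k) * leibniz_term (Suc n) m a b c d t k)"
    if "t \<noteq> 0" for t
    using scaled[of t] that by (simp del: sum.atMost_Suc)
  \<comment> \<open>The induction hypothesis is used at $t \pm \frac12$, so the point \<open>t = 0\<close>, where division
    by \<open>2 t\<close> fails, cannot be left out.\<close>
  show ?case
    by (rule continuous_eq_off_0[where t = t, OF _ _ off_0])
      (auto simp only: leibniz_term_def intro!: continuous_intros)
qed

theorem mainTheorem4:
  fixes a b c d :: real and n m :: nat and x :: complex
  assumes "a > 0" and "b > 0" and "c > 0" and "d > 0"
  shows "poly (wilson (m + n) (of_real a) (of_real b) (of_real c) (of_real d)) (x\<^sup>2) =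
    (\<Sum>k = 0..min n m.
       pochhammer (- of_nat n) k * pochhammer (- of_nat m) k / fact k *
       pochhammer (of_nat m + of_real a + of_real b + of_real c + of_real d + 2 * of_nat n - 1) k *
       pochhammer (of_real a + \<i> * x) k * pochhammer (of_real b + \<i> * x) k *
       pochhammer (of_real c + \<i> * x) k * pochhammer (of_real d + \<i> * x) k *
       poly (wilson (n - k) (of_real a + of_nat k / 2) (of_real b + of_nat k / 2)
                            (of_real c + of_nat k / 2) (of_real d + of_nat k / 2))
            ((x - 1 / 2 * of_nat k * \<i>)\<^sup>2) *
       poly (wilson (m - k) (of_real a + of_nat (n + k) / 2) (of_real b + of_nat (n + k) / 2)
                            (of_real c + of_nat (n + k) / 2) (of_real d + of_nat (n + k) / 2))
            ((x + 1 / 2 * \<i> * of_nat (n - k))\<^sup>2))"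
proof -
  let ?a = "of_real a :: complex" and ?b = "of_real b :: complex"
    and ?c = "of_real c :: complex" and ?d = "of_real d :: complex"
  let ?L = "leibniz_term n m ?a ?b ?c ?d (\<i> * x)"
  have "poly (wilson (m + n) ?a ?b ?c ?d) (x\<^sup>2) = (\<Sum>k\<le>n. of_nat (n choose k) * ?L k)"
    using assms by (simp add: poly_wilson_eq_wilson_at wilson_at_add)
  also have "\<dots> = (\<Sum>k = 0..min n m. of_nat (n choose k) * ?L k)"
    by (rule sum.mono_neutral_right)
      (auto simp: leibniz_term_def pochhammer_of_nat_eq_0_lemma)
  finally show ?thesis
  proof (rule trans, intro sum.cong refl)
    fix k assume "k \<in> {0..min n m}"
    then have k: "k \<le> n" by simp
    have binom: "pochhammer (- of_nat n) k / fact k = (-1) ^ k * (of_nat (n choose k) :: complex)"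
      by (simp add: binomial_gbinomial gbinomial_pochhammer)
    have pos: "Re (of_real e + of_nat l / 2) > 0" if "e > 0" for e l
      using that by (simp add: add_pos_nonneg)
    have arg: "\<i> * (x - 1 / 2 * of_nat k * \<i>) = \<i> * x + of_nat k / 2"
      "\<i> * (x + 1 / 2 * \<i> * of_nat (n - k)) = \<i> * x - (of_nat n - of_nat k) / 2"
      using k by (simp_all add: of_nat_diff field_simps)
    show "of_nat (n choose k) * ?L k =
       pochhammer (- of_nat n) k * pochhammer (- of_nat m) k / fact k *
       pochhammer (of_nat m + ?a + ?b + ?c + ?d + 2 * of_nat n - 1) k *
       pochhammer (?a + \<i> * x) k * pochhammer (?b + \<i> * x) k *
       pochhammer (?c + \<i> * x) k * pochhammer (?d + \<i> * x) k *
       poly (wilson (n - k) (?a + of_nat k / 2) (?b + of_nat k / 2)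
                            (?c + of_nat k / 2) (?d + of_nat k / 2))
            ((x - 1 / 2 * of_nat k * \<i>)\<^sup>2) *
       poly (wilson (m - k) (?a + of_nat (n + k) / 2) (?b + of_nat (n + k) / 2)
                            (?c + of_nat (n + k) / 2) (?d + of_nat (n + k) / 2))
            ((x + 1 / 2 * \<i> * of_nat (n - k))\<^sup>2)"
      unfolding poly_wilson_eq_wilson_at[OF pos[OF assms(1)] pos[OF assms(2)]
          pos[OF assms(3)] pos[OF assms(4)]] arg leibniz_term_def
        times_divide_eq_left[of "pochhammer (- of_nat n) k", symmetric] binom
      by (simp only: mult_ac)
  qed
qed

end
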